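(* Let $(\mathbf{A},\tau)$ be an $n$-subtractive $T_0$-topological algebra, let $1\le i\le n-1$, and let $a,b\in \mathrm{Diag}_i(\mathbf{A})$. (i) If $s_i(a,b)\neq 0$, then $a$ and $b$ are $T_2$-separated in the subspace $\mathrm{Diag}_i(\mathbf{A})$. (ii) If $s_i(a,b)$ and $0$ are $T_2$-separated in $A$, then $a$ and $b$ are $T_{2\frac12}$-separated in the subspace $\mathrm{Diag}_i(\mathbf{A})$.
   Context: An algebra $\mathbf{A}$ is $n$-subtractive ($n\ge2$) with respect to a constant $0$ and binary terms $s_1,\dots,s_{n-1}$ if it satisfies $s_1(x,x)=0$, $s_j(x,0)=s_{j+1}(x,x)$ for $j=1,\dots,n-2$, and $s_{n-1}(x,0)=x$. $\mathrm{Diag}_i(\mathbf{A})=\{a\in A: s_i(a,a)=0\}$, with the subspace topology. A topological algebra is an algebra with a topology making every basic operation continuous (domain with product topology); it is $T_0$ if the topology is $T_0$. Points $c,d$ are $T_2$-separated if they have disjoint open neighbourhoods, and $T_{2\frac12}$-separated if they have open neighbourhoods $U\ni c$, $V\ni d$ whose closures are disjoint. *)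

theory Defs
  imports "HOL-Analysis.Analysis"
begin

text \<open>A finitary algebra is given by a signature \<open>ar :: 'f \<Rightarrow> nat\<close> (a type of operation symbols with
  their arities), a carrier \<open>A\<close> and an interpretation \<open>I\<close>. Only the values of \<open>I f\<close> on lists over \<open>A\<close>
  of length \<open>ar f\<close> are relevant.\<close>

definition universal_algebra ::
    "('f \<Rightarrow> nat) \<Rightarrow> ('f \<Rightarrow> 'a list \<Rightarrow> 'a) \<Rightarrow> 'a set \<Rightarrow> bool" where
  "universal_algebra ar I A \<longleftrightarrow>
     (\<forall>f xs. length xs = ar f \<and> set xs \<subseteq> A \<longrightarrow> I f xs \<in> A)"

datatype 'f trm = TVar nat | TOp 'f "'f trm list"

primrec trm_vars :: "'f trm \<Rightarrow> nat set" where
  "trm_vars (TVar v) = {v}"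
| "trm_vars (TOp f ts) = \<Union> (set (map trm_vars ts))"

primrec wf_trm :: "('f \<Rightarrow> nat) \<Rightarrow> 'f trm \<Rightarrow> bool" where
  "wf_trm ar (TVar v) \<longleftrightarrow> True"
| "wf_trm ar (TOp f ts) \<longleftrightarrow> length ts = ar f \<and> list_all id (map (wf_trm ar) ts)"

definition trm_arity :: "('f \<Rightarrow> nat) \<Rightarrow> nat \<Rightarrow> 'f trm \<Rightarrow> bool" where
  "trm_arity ar k t \<longleftrightarrow> wf_trm ar t \<and> trm_vars t \<subseteq> {..<k}"

text \<open>The term operation of a \<open>k\<close>-ary term: the variable \<open>TVar v\<close> denotes the \<open>v\<close>-th entry of the
  argument list, counted from 0.\<close>

primrec trm_op :: "('f \<Rightarrow> 'a list \<Rightarrow> 'a) \<Rightarrow> 'f trm \<Rightarrow> 'a list \<Rightarrow> 'a" where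
  "trm_op I (TVar v) xs = xs ! v"
| "trm_op I (TOp f ts) xs = I f (map (\<lambda>t. trm_op I t xs) ts)"

text \<open>The constant is a term \<open>z\<close> without variables; a constant symbol \<open>c\<close> is the case \<open>TOp c []\<close>.\<close>

definition n_subtractive ::
    "('f \<Rightarrow> nat) \<Rightarrow> ('f \<Rightarrow> 'a list \<Rightarrow> 'a) \<Rightarrow> 'a set \<Rightarrow> nat \<Rightarrow> 'f trm \<Rightarrow> (nat \<Rightarrow> 'f trm) \<Rightarrow> bool" where
  "n_subtractive ar I A n z s \<longleftrightarrow>
     n \<ge> 2 \<and> trm_arity ar 0 z \<and> (\<forall>j\<in>{1..n - 1}. trm_arity ar 2 (s j)) \<and>
     (\<forall>x\<in>A. trm_op I (s 1) [x, x] = trm_op I z []) \<and>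
     (\<forall>j\<in>{1..n - 2}. \<forall>x\<in>A. trm_op I (s j) [x, trm_op I z []] = trm_op I (s (j + 1)) [x, x]) \<and>
     (\<forall>x\<in>A. trm_op I (s (n - 1)) [x, trm_op I z []] = x)"

definition Diag ::
    "('f \<Rightarrow> 'a list \<Rightarrow> 'a) \<Rightarrow> 'a set \<Rightarrow> 'f trm \<Rightarrow> (nat \<Rightarrow> 'f trm) \<Rightarrow> nat \<Rightarrow> 'a set" where
  "Diag I A z s i = {a \<in> A. trm_op I (s i) [a, a] = trm_op I z []}"

text \<open>The domain of \<open>I f\<close> carries the product topology on the power with index set \<open>{..<ar f}\<close>, whose
  points are functions on that index set; \<open>map x [0..<ar f]\<close> is the tuple \<open>x\<close> written as a list.\<close>

definition topological_algebra ::
    "('f \<Rightarrow> nat) \<Rightarrow> ('f \<Rightarrow> 'a list \<Rightarrow> 'a) \<Rightarrow> 'a set \<Rightarrow> 'a topology \<Rightarrow> bool" where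
  "topological_algebra ar I A \<tau> \<longleftrightarrow>
     universal_algebra ar I A \<and> topspace \<tau> = A \<and>
     (\<forall>f. continuous_map (product_topology (\<lambda>_. \<tau>) {..<ar f}) \<tau> (\<lambda>x. I f (map x [0..<ar f])))"

definition T2_separated :: "'a topology \<Rightarrow> 'a \<Rightarrow> 'a \<Rightarrow> bool" where
  "T2_separated X c d \<longleftrightarrow>
     (\<exists>U V. openin X U \<and> openin X V \<and> c \<in> U \<and> d \<in> V \<and> disjnt U V)"

definition T2half_separated :: "'a topology \<Rightarrow> 'a \<Rightarrow> 'a \<Rightarrow> bool" where
  "T2half_separated X c d \<longleftrightarrow>
     (\<exists>U V. openin X U \<and> openin X V \<and> c \<in> U \<and> d \<in> V \<and>
            disjnt (X closure_of U) (X closure_of V))"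

end

theory Submission
  imports Defs
begin

text \<open>
  Write \<open>x \<le> y\<close> if every open set containing \<open>x\<close> contains \<open>y\<close>; term operations are monotone for this
  preorder. If \<open>c \<le> 0\<close>, then \<open>0 = s\<^sub>1(c,c) \<le> s\<^sub>1(c,0) = s\<^sub>2(c,c) \<le> \<dots> \<le> s\<^sub>n\<^sub>-\<^sub>1(c,0) = c\<close>, so \<open>c = 0\<close> by
  \<open>T\<^sub>0\<close>. Hence every \<open>c \<noteq> 0\<close> has an open neighbourhood \<open>U\<close> missing \<open>0\<close>. For \<open>c = s\<^sub>i(a,b)\<close>, an open
  rectangle around \<open>(a,b)\<close> that \<open>s\<^sub>i\<close> maps into \<open>U\<close> cannot meet the diagonal of \<open>Diag\<^sub>i\<close>, where \<open>s\<^sub>i\<close>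
  vanishes; if \<open>0\<close> moreover has a neighbourhood disjoint from \<open>U\<close>, the same holds for the product of
  the closures of the sides.
\<close>

text \<open>Allowing any list of continuous maps on any space \<open>X\<close> as arguments lets the
  induction on terms go through: the subterms of \<open>TOp f ts\<close> combine to one map into the
  power of \<open>\<tau>\<close>, followed by \<open>I f\<close>. Binary terms take
  \<open>gs = [fst, snd]\<close>, closed terms \<open>gs = []\<close>.\<close>

lemma continuous_map_trm_op:
  assumes alg: "topological_algebra ar I A \<tau>"
    and "trm_arity ar (length gs) t"
    and gs: "\<And>g. g \<in> set gs \<Longrightarrow> continuous_map X \<tau> g"
  shows "continuous_map X \<tau> (\<lambda>x. trm_op I t (map (\<lambda>g. g x) gs))"
  using assms(2)
proof (induction t)
  case (TVar v)
  then have "v < length gs"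
    by (simp add: trm_arity_def)
  with gs show ?case
    by simp
next
  case (TOp f ts)
  \<comment> \<open>Points of the product topology are extensional functions, hence the restriction
    to \<open>{..<ar f}\<close>; the list over \<open>[0..<ar f]\<close> does not see it.\<close>
  let ?h = "\<lambda>x. \<lambda>j\<in>{..<ar f}. trm_op I (ts ! j) (map (\<lambda>g. g x) gs)"
  have len: "length ts = ar f"
    using TOp.prems by (simp add: trm_arity_def)
  have "trm_arity ar (length gs) t" if "t \<in> set ts" for t
    using TOp.prems that by (auto simp: trm_arity_def list_all_iff)
  with TOp.IH have "continuous_map X \<tau> (\<lambda>x. trm_op I (ts ! j) (map (\<lambda>g. g x) gs))"
    if "j < ar f" for j
    using that len by simp
  then have "continuous_map X (product_topology (\<lambda>_. \<tau>) {..<ar f}) ?h"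
    by (auto simp: continuous_map_componentwise)
  moreover have "continuous_map (product_topology (\<lambda>_. \<tau>) {..<ar f}) \<tau>
      (\<lambda>x. I f (map x [0..<ar f]))"
    using alg by (simp add: topological_algebra_def)
  ultimately have "continuous_map X \<tau> (\<lambda>x. I f (map (?h x) [0..<ar f]))"
    by (auto dest: continuous_map_compose simp: o_def)
  moreover have "map (?h x) [0..<ar f] = map (\<lambda>t. trm_op I t (map (\<lambda>g. g x) gs)) ts" for x
    using len by (auto intro: nth_equalityI)
  ultimately show ?case
    by simp
qed

lemma continuous_map_binary_trm_op:
  assumes "topological_algebra ar I A \<tau>" and "trm_arity ar 2 t"
  shows "continuous_map (prod_topology \<tau> \<tau>) \<tau> (\<lambda>p. trm_op I t [fst p, snd p])"
proof -
  have "continuous_map (prod_topology \<tau> \<tau>) \<tau> g" if "g \<in> set [fst, snd]" for g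
    using that by (auto simp: continuous_map_fst continuous_map_snd)
  moreover have "trm_arity ar (length [fst, snd]) t"
    using assms(2) by (simp add: numeral_2_eq_2)
  ultimately show ?thesis
    using continuous_map_trm_op[OF assms(1), where gs = "[fst, snd]"] by simp
qed

text \<open>A closed term gives a constant continuous map; its value at any point of
  \<open>A\<close> lies in the topspace.\<close>

lemma closed_trm_op_in_carrier:
  assumes "topological_algebra ar I A \<tau>" and "trm_arity ar 0 z" and "A \<noteq> {}"
  shows "trm_op I z [] \<in> A"
  using continuous_map_trm_op[OF assms(1), where gs = "[]" and t = z and X = \<tau>] assms
  by (auto simp: continuous_map_def topological_algebra_def)

lemma continuous_map_prod_open_rectangle:
  assumes "continuous_map (prod_topology X Y) Z f" and "openin Z U"
    and "x \<in> topspace X" and "y \<in> topspace Y" and "f (x, y) \<in> U"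
  obtains V W where "openin X V" "openin Y W" "x \<in> V" "y \<in> W"
    "\<And>u v. u \<in> V \<Longrightarrow> v \<in> W \<Longrightarrow> f (u, v) \<in> U"
proof -
  have "openin (prod_topology X Y) {p \<in> topspace (prod_topology X Y). f p \<in> U}"
    using assms(1,2) by (rule openin_continuous_map_preimage)
  moreover have "(x, y) \<in> {p \<in> topspace (prod_topology X Y). f p \<in> U}"
    using assms(3-5) by simp
  ultimately obtain V W where "openin X V" "openin Y W" "x \<in> V" "y \<in> W"
      "V \<times> W \<subseteq> {p \<in> topspace (prod_topology X Y). f p \<in> U}"
    unfolding openin_prod_topology_alt by meson
  then show thesis
    by (intro that) auto
qed

lemma n_subtractive_open_nbhd_missing_zero:
  assumes alg: "topological_algebra ar I A \<tau>" and t0: "t0_space \<tau>"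
    and sub: "n_subtractive ar I A n z s"
    and c: "c \<in> A" "c \<noteq> trm_op I z []"
  obtains U where "openin \<tau> U" "c \<in> U" "trm_op I z [] \<notin> U"
proof (rule ccontr)
  let ?o = "trm_op I z []"
  assume "\<not> thesis"
  \<comment> \<open>Without such a neighbourhood, \<open>c\<close> is below \<open>?o\<close> in the
    preorder; \<open>above\<close> will give the converse, against \<open>T0\<close>.\<close>
  with that have below: "?o \<in> U" if "openin \<tau> U" "c \<in> U" for U
    using \<open>openin \<tau> U\<close> \<open>c \<in> U\<close> by blast
  have A: "topspace \<tau> = A"
    using alg by (simp add: topological_algebra_def)
  have n: "n \<ge> 2"
    using sub by (simp add: n_subtractive_def)
  \<comment> \<open>Only the second argument moves: in a rectangle \<open>V \<times> W\<close>
    around \<open>(c, c)\<close>, the side \<open>W\<close> contains \<open>?o\<close> by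
    \<open>below\<close>.\<close>
  have step: "trm_op I (s j) [c, ?o] \<in> U"
    if "openin \<tau> U" "trm_op I (s j) [c, c] \<in> U" "j \<in> {1..n - 1}" for j U
  proof -
    have "trm_arity ar 2 (s j)"
      using sub that(3) by (simp add: n_subtractive_def)
    from continuous_map_binary_trm_op[OF alg this] that(1,2) c(1) A
    obtain V W where "openin \<tau> V" "openin \<tau> W" "c \<in> V" "c \<in> W"
      "\<And>u v. u \<in> V \<Longrightarrow> v \<in> W \<Longrightarrow> trm_op I (s j) [u, v] \<in> U"
      by (auto elim: continuous_map_prod_open_rectangle[where x = c and y = c])
    with below show ?thesis
      by blast
  qed
  have above: "c \<in> U" if U: "openin \<tau> U" "?o \<in> U" for U
  proof -
    \<comment> \<open>The indices are shifted: \<open>Suc j\<close> runs from 1 to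
      \<open>n - 1\<close>. The start is \<open>s\<^sub>1(c,c) = 0\<close>, which lies in
      \<open>U\<close>.\<close>
    have "j \<le> n - 2 \<Longrightarrow> trm_op I (s (Suc j)) [c, ?o] \<in> U" for j
    proof (induction j)
      case 0
      show ?case
        using step[of U "Suc 0"] U sub c(1) n by (auto simp: n_subtractive_def)
    next
      case (Suc j)
      then have "Suc j \<in> {1..n - 2}"
        by simp
      then have "trm_op I (s (Suc j)) [c, ?o] = trm_op I (s (Suc j + 1)) [c, c]"
        using sub c(1) unfolding n_subtractive_def by blast
      then have "trm_op I (s (Suc (Suc j))) [c, c] \<in> U"
        using Suc by simp
      then show ?case
        using Suc.prems step[of U "Suc (Suc j)"] U(1) by simp
    qed
    from this[of "n - 2"] have "trm_op I (s (n - 1)) [c, ?o] \<in> U"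
      using n by (simp add: Suc_diff_le numeral_2_eq_2 Suc_diff_Suc)
    then show ?thesis
      using sub c(1) by (simp add: n_subtractive_def)
  qed
  have "?o \<in> A"
    using closed_trm_op_in_carrier[OF alg] sub c(1) by (auto simp: n_subtractive_def)
  then obtain U where "openin \<tau> U" "(c \<in> U) \<noteq> (?o \<in> U)"
    using t0 c A unfolding t0_space_def by metis
  with below above show False
    by blast
qed

theorem theorem6p9:
  fixes ar :: "'f \<Rightarrow> nat" and I :: "'f \<Rightarrow> 'a list \<Rightarrow> 'a" and A :: "'a set" and \<tau> :: "'a topology"
    and n i :: nat and z :: "'f trm" and s :: "nat \<Rightarrow> 'f trm" and a b :: 'a
  assumes "topological_algebra ar I A \<tau>"
    and "t0_space \<tau>"
    and "n_subtractive ar I A n z s"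
    and "1 \<le> i" and "i \<le> n - 1"
    and "a \<in> Diag I A z s i" and "b \<in> Diag I A z s i"
  shows "(trm_op I (s i) [a, b] \<noteq> trm_op I z [] \<longrightarrow>
            T2_separated (subtopology \<tau> (Diag I A z s i)) a b) \<and>
         (T2_separated \<tau> (trm_op I (s i) [a, b]) (trm_op I z []) \<longrightarrow>
            T2half_separated (subtopology \<tau> (Diag I A z s i)) a b)"
proof -
  let ?o = "trm_op I z []" and ?f = "\<lambda>x y. trm_op I (s i) [x, y]"
  let ?D = "Diag I A z s i"
  let ?X = "subtopology \<tau> ?D"
  have A: "topspace \<tau> = A"
    using assms(1) by (simp add: topological_algebra_def)
  have D: "x \<in> A" "?f x x = ?o" if "x \<in> ?D" for x
    using that by (auto simp: Diag_def)
  have cont: "continuous_map (prod_topology \<tau> \<tau>) \<tau> (\<lambda>p. ?f (fst p) (snd p))"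
    using assms by (intro continuous_map_binary_trm_op) (auto simp: n_subtractive_def)
  then have "?f x y \<in> A" if "x \<in> A" "y \<in> A" for x y
    using that A by (force simp: continuous_map_def)
  then have ab: "?f a b \<in> A"
    using D assms(6,7) by blast
  \<comment> \<open>Used at \<open>(a, b)\<close> in both parts, and in the second also at a
    diagonal point \<open>(x, x)\<close>.\<close>
  have rectangle: "\<exists>V W. openin \<tau> V \<and> openin \<tau> W \<and> x \<in> V \<and> y \<in> W \<and> (\<forall>u\<in>V. \<forall>v\<in>W. ?f u v \<in> U)"
    if "openin \<tau> U" "?f x y \<in> U" "x \<in> ?D" "y \<in> ?D" for U x y
    using continuous_map_prod_open_rectangle[OF cont that(1), of x y] that D A
    by (metis fst_conv snd_conv)
  have "T2_separated ?X a b" if ne: "?f a b \<noteq> ?o"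
  proof -
    obtain U where U: "openin \<tau> U" "?f a b \<in> U" "?o \<notin> U"
      using n_subtractive_open_nbhd_missing_zero[OF assms(1-3) ab ne] by blast
    from rectangle[OF U(1,2) assms(6,7)] obtain V W where VW:
        "openin \<tau> V" "openin \<tau> W" "a \<in> V" "b \<in> W" "\<forall>u\<in>V. \<forall>v\<in>W. ?f u v \<in> U"
      by blast
    \<comment> \<open>A common point \<open>u\<close> would give
      \<open>?o = ?f u u \<in> U\<close>.\<close>
    have "disjnt (?D \<inter> V) (?D \<inter> W)"
      using D(2) VW(5) U(3) by (fastforce simp: disjnt_def)
    with VW assms(6,7) show ?thesis
      unfolding T2_separated_def by (meson IntI openin_subtopology_Int2)
  qed
  moreover have "T2half_separated ?X a b" if sep: "T2_separated \<tau> (?f a b) ?o"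
  proof -
    obtain U U' where U: "openin \<tau> U" "openin \<tau> U'" "?f a b \<in> U" "?o \<in> U'" "disjnt U U'"
      using sep unfolding T2_separated_def by blast
    from rectangle[OF U(1,3) assms(6,7)] obtain V W where VW:
        "openin \<tau> V" "openin \<tau> W" "a \<in> V" "b \<in> W" "\<forall>u\<in>V. \<forall>v\<in>W. ?f u v \<in> U"
      by blast
    \<comment> \<open>Near \<open>(x, x)\<close> the values of \<open>?f\<close> lie in
      \<open>U'\<close>, while \<open>P\<close> meets \<open>V\<close> in some \<open>u\<close> and
      \<open>Q\<close> meets \<open>W\<close> in some \<open>v\<close>. So \<open>?f u v\<close>
      lies in both \<open>U\<close> and \<open>U'\<close>.\<close>
    have False if x: "x \<in> ?X closure_of (?D \<inter> V)" "x \<in> ?X closure_of (?D \<inter> W)" for x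
    proof -
      have "x \<in> ?D"
        using x(1) by (auto simp: in_closure_of)
      with D(2) U(4) have "?f x x \<in> U'"
        by simp
      from rectangle[OF U(2) this \<open>x \<in> ?D\<close> \<open>x \<in> ?D\<close>] obtain P Q where PQ:
          "openin \<tau> P" "openin \<tau> Q" "x \<in> P" "x \<in> Q" "\<forall>u\<in>P. \<forall>v\<in>Q. ?f u v \<in> U'"
        by blast
      \<comment> \<open>The closures are taken in the subspace, so \<open>P\<close> and
        \<open>Q\<close> are replaced by their traces on \<open>?D\<close>.\<close>
      have "openin ?X (?D \<inter> P)" "openin ?X (?D \<inter> Q)"
        using PQ by (auto intro: openin_subtopology_Int2)
      with x \<open>x \<in> ?D\<close> PQ(3,4) obtain u v where "u \<in> V" "u \<in> P" "v \<in> W" "v \<in> Q"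
        unfolding in_closure_of by (metis IntE IntI)
      with VW(5) PQ(5) U(5) show False
        unfolding disjnt_iff by blast
    qed
    then have "disjnt (?X closure_of (?D \<inter> V)) (?X closure_of (?D \<inter> W))"
      by (auto simp: disjnt_iff)
    with VW assms(6,7) show ?thesis
      unfolding T2half_separated_def by (meson IntI openin_subtopology_Int2)
  qed
  ultimately show ?thesis
    by blast
qed

end
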